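(* For $n\geq 1$, $$C_{n+1}^E(x)=(2nx+1)C_n^E(x)+2x(1-x)\frac{d}{dx}C_n^E(x)+xC_n^O(x),$$ $$C_{n+1}^O(x)=((2n-1)x+2)C_n^O(x)+2x(1-x)\frac{d}{dx}C_n^O(x)+C_n^E(x),$$ with $C_1^E(x)=C_1^O(x)=1$. Moreover, both $C_n^E(x)$ and $C_n^O(x)$ have only real negative zeros and $C_n^O(x)\prec C_n^E(x)$.
   Context: Let $\mathcal{S}^B_n$ be the set of signed permutations $\pi$ of $\pm[n]$ with $\pi(-i)=-\pi(i)$, written $\pi=\pi(1)\cdots\pi(n)$, entries compared in the usual integer order. Let ${\rm des}_A(\pi)=\#\{i\in[n-1]:\pi(i)>\pi(i+1)\}$. Let $C_n^+=\{\pi\in\mathcal{S}^B_n:\pi(1)>0\}$, $C_n^-=\{\pi\in\mathcal{S}^B_n:\pi(1)<0\}$, $C_n^E(x)=\sum_{\pi\in C_n^+}x^{{\rm des}_A(\pi)}$ and $C_n^O(x)=\sum_{\pi\in C_n^-}x^{{\rm des}_A(\pi)}$. For real-rooted polynomials $p,q$ with zeros $\xi_1\le\cdots\le\xi_n$ and $\theta_1\le\cdots\le\theta_m$ respectively, $p\prec q$ means either $\deg q=\deg p+1$ and $\theta_1\le\xi_1\le\theta_2\le\cdots\le\xi_n\le\theta_{n+1}$ ($p$ interlaces $q$), or $\deg p=\deg q$ and $\xi_1\le\theta_1\le\xi_2\le\cdots\le\xi_n\le\theta_n$ ($p$ alternates left of $q$). *)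

theory Defs
  imports Complex_Main "HOL-Computational_Algebra.Polynomial" "HOL-Combinatorics.Permutations"
begin

definition pm_interval :: "nat \<Rightarrow> int set" where
  "pm_interval n = {- int n..int n} - {0}"

text \<open>A signed permutation is a function on all integers; \<^const>\<open>permutes\<close> makes it the
  identity outside \<open>pm_interval n\<close>, so each signed permutation is represented exactly once.\<close>

definition signed_perms :: "nat \<Rightarrow> (int \<Rightarrow> int) set" where
  "signed_perms n =
     {\<pi>. \<pi> permutes pm_interval n \<and> (\<forall>i\<in>pm_interval n. \<pi> (- i) = - \<pi> i)}"

definition des_A :: "nat \<Rightarrow> (int \<Rightarrow> int) \<Rightarrow> nat" where
  "des_A n \<pi> = card {i \<in> {1..int n - 1}. \<pi> i > \<pi> (i + 1)}"

definition C_plus :: "nat \<Rightarrow> (int \<Rightarrow> int) set" where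
  "C_plus n = {\<pi> \<in> signed_perms n. \<pi> 1 > 0}"

definition C_minus :: "nat \<Rightarrow> (int \<Rightarrow> int) set" where
  "C_minus n = {\<pi> \<in> signed_perms n. \<pi> 1 < 0}"

definition C_E :: "nat \<Rightarrow> real poly" where
  "C_E n = (\<Sum>\<pi>\<in>C_plus n. monom 1 (des_A n \<pi>))"

definition C_O :: "nat \<Rightarrow> real poly" where
  "C_O n = (\<Sum>\<pi>\<in>C_minus n. monom 1 (des_A n \<pi>))"

text \<open>Quantifying over complex zeros excludes the zero polynomial; nonzero constants are
  real-rooted.\<close>

definition real_rooted :: "real poly \<Rightarrow> bool" where
  "real_rooted p \<longleftrightarrow> (\<forall>z::complex. poly (map_poly complex_of_real p) z = 0 \<longrightarrow> z \<in> \<real>)"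

definition only_real_negative_zeros :: "real poly \<Rightarrow> bool" where
  "only_real_negative_zeros p \<longleftrightarrow>
     (\<forall>z::complex. poly (map_poly complex_of_real p) z = 0 \<longrightarrow> z \<in> \<real> \<and> Re z < 0)"

definition zeros :: "real poly \<Rightarrow> real list" where
  "zeros p = sorted_list_of_multiset (proots p)"

text \<open>Zeros are listed in weakly increasing order with multiplicity, indexed from 0, so for a
  real-rooted polynomial the list has length \<open>degree p\<close>.\<close>

definition interlaces :: "real poly \<Rightarrow> real poly \<Rightarrow> bool" where
  "interlaces p q \<longleftrightarrow> degree q = degree p + 1 \<and>
     (\<forall>i<degree p. zeros q ! i \<le> zeros p ! i \<and> zeros p ! i \<le> zeros q ! (i + 1))"

definition alternates_left :: "real poly \<Rightarrow> real poly \<Rightarrow> bool" where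
  "alternates_left p q \<longleftrightarrow> degree p = degree q \<and>
     (\<forall>i<degree p. zeros p ! i \<le> zeros q ! i) \<and>
     (\<forall>i. i + 1 < degree p \<longrightarrow> zeros q ! i \<le> zeros p ! (i + 1))"

definition root_prec :: "real poly \<Rightarrow> real poly \<Rightarrow> bool" where
  "root_prec p q \<longleftrightarrow>
     real_rooted p \<and> real_rooted q \<and> (interlaces p q \<or> alternates_left p q)"

end

theory Submission
  imports Defs "HOL-Computational_Algebra.Fundamental_Theorem_Algebra"
begin

text \<open>The recurrences come from inserting \<open>n + 1\<close> or \<open>-(n + 1)\<close> at every place of a signed word: in
  the interior, the descent number grows exactly when an ascent is split. For the zeros, the
  recurrences imply \<open>C\<^sup>E\<^sub>n(t\<^sup>2) + t C\<^sup>O\<^sub>n(t\<^sup>2) = (1 + t)^n A_n(t)\<close> with \<open>A_n\<close> the classical Eulerian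
  polynomial. The polynomial on the right is a product of factors \<open>t + r\<close> with \<open>r > 0\<close>, and the even
  and odd parts of such a product interlace (a case of the Hermite--Biehler theorem), which is shown
  by adding one factor at a time.\<close>

subsection \<open>Signed words and insertion\<close>

text \<open>Setting \<open>x = t^2\<close> and giving a negative first entry the weight
  \<open>t\<close> counts signed permutations by the flag descent number, twice \<open>des_A\<close>
  plus 1 if the first entry is negative. For this generating function F_n the two coupled
  recurrences become the single one F_(n+1) = (1 + t + 2nt^2) F_n + t(1 - t^2) F_n', which (1 + t)^n
  A_n satisfies as well. The product has -1 as a multiple zero for n > 1, yet its even and odd parts
  have simple zeros: a new factor t + r replaces (p, q) by (r p + x q, p + r q), and r > 0 makes
  every sign change strict. What enters about A_n is therefore only that its zeros are real and
  negative. The n factors 1 + t and the n - 1 factors of A_n give 2n - 1 factors and 2n - 2 zeros in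
  all, n - 1 for each part. The degrees agree, so \<open>root_prec\<close> holds through
  \<open>alternates_left\<close>; the largest zero belongs to \<open>C_E n\<close>.\<close>

fun desc :: "int list \<Rightarrow> nat" where
  "desc (a # b # w) = of_bool (a > b) + desc (b # w)"
| "desc _ = 0"

text \<open>The length and the image under \<open>abs\<close> together force the absolute values to
  be distinct.\<close>

definition signed_words :: "nat \<Rightarrow> int list set" where
  "signed_words n = {w. length w = n \<and> abs ` set w = {1..int n}}"

definition insert_at :: "nat \<Rightarrow> 'a \<Rightarrow> 'a list \<Rightarrow> 'a list" where
  "insert_at k x w = take k w @ x # drop k w"

lemma insert_at_0 [simp]: "insert_at 0 x w = x # w"
  by (simp add: insert_at_def)

lemma insert_at_Suc_Cons [simp]: "insert_at (Suc k) x (a # w) = a # insert_at k x w"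
  by (simp add: insert_at_def)

lemma set_insert_at [simp]: "set (insert_at k x w) = insert x (set w)"
  by (simp add: insert_at_def) (metis append_take_drop_id set_append)

lemma length_insert_at [simp]: "length (insert_at k x w) = Suc (length w)"
  by (simp add: insert_at_def)

lemma desc_conv_sum:
  "desc w = (\<Sum>i<length w - 1. of_bool (w ! i > w ! Suc i))"
  by (induction w rule: desc.induct) (auto simp: sum.lessThan_Suc_shift simp del: sum.lessThan_Suc)

lemma desc_Cons_max:
  assumes "w \<noteq> []" "\<forall>a\<in>set w. a < x"
  shows "desc (x # w) = Suc (desc w)"
  using assms by (cases w) auto

lemma desc_Cons_min:
  assumes "\<forall>a\<in>set w. x < a"
  shows "desc (x # w) = desc w"
  using assms by (cases w) auto

text \<open>A maximum put into a descent or at the end leaves \<open>desc\<close> unchanged, and put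
  into an ascent it adds one: \<open>1 + desc w\<close> places against the remaining ones. The front
  place is left out because it changes the head.\<close>

lemma sum_insert_max:
  assumes "w \<noteq> []" "\<forall>a\<in>set w. a < x"
  shows "(\<Sum>k<length w. monom 1 (desc (insert_at (Suc k) x w))) =
    monom (1 + real (desc w)) (desc w) +
    monom (real (length w) - 1 - real (desc w)) (Suc (desc w))"
  using assms
proof (induction w rule: desc.induct)
  case (1 a b w)
  have IH: "(\<Sum>k<length (b # w). monom 1 (desc (insert_at (Suc k) x (b # w)))) =
    monom (1 + real (desc (b # w))) (desc (b # w)) +
    monom (real (length (b # w)) - 1 - real (desc (b # w))) (Suc (desc (b # w)))"
    using 1 by auto
  have mult: "monom 1 (e + d) = monom (1::real) e * monom 1 d" for e d
    by (simp add: mult_monom)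
  \<comment> \<open>The place between \<open>a\<close> and \<open>b\<close> is split off; all later
    places keep the pair \<open>a\<close>, \<open>b\<close>, whose contribution factors out.\<close>
  have "(\<Sum>k<length (a # b # w). monom 1 (desc (insert_at (Suc k) x (a # b # w)))) =
    monom 1 (desc (a # x # b # w)) +
    monom 1 (of_bool (a > b)) *
      (\<Sum>k<length (b # w). monom (1::real) (desc (insert_at (Suc k) x (b # w))))"
    by (simp add: sum.lessThan_Suc_shift mult sum_distrib_left distrib_left
             del: sum.lessThan_Suc)
  also have "\<dots> = monom (1 + real (desc (a # b # w))) (desc (a # b # w)) +
    monom (real (length (a # b # w)) - 1 - real (desc (a # b # w))) (Suc (desc (a # b # w)))"
    using "1.prems" unfolding IH
    by (auto simp: distrib_left mult_monom add_monom add.assoc algebra_simps)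
  finally show ?case .
qed auto

text \<open>Unlike a maximum, a minimum at the end creates a descent, so only the
  \<open>desc w\<close> descents are neutral places.\<close>

lemma sum_insert_min:
  assumes "w \<noteq> []" "\<forall>a\<in>set w. x < a"
  shows "(\<Sum>k<length w. monom 1 (desc (insert_at (Suc k) x w))) =
    monom (real (desc w)) (desc w) +
    monom (real (length w) - real (desc w)) (Suc (desc w))"
  using assms
proof (induction w rule: desc.induct)
  case (1 a b w)
  have IH: "(\<Sum>k<length (b # w). monom 1 (desc (insert_at (Suc k) x (b # w)))) =
    monom (real (desc (b # w))) (desc (b # w)) +
    monom (real (length (b # w)) - real (desc (b # w))) (Suc (desc (b # w)))"
    using 1 by auto
  have mult: "monom 1 (e + d) = monom (1::real) e * monom 1 d" for e d
    by (simp add: mult_monom)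
  have "(\<Sum>k<length (a # b # w). monom 1 (desc (insert_at (Suc k) x (a # b # w)))) =
    monom 1 (desc (a # x # b # w)) +
    monom 1 (of_bool (a > b)) *
      (\<Sum>k<length (b # w). monom (1::real) (desc (insert_at (Suc k) x (b # w))))"
    by (simp add: sum.lessThan_Suc_shift mult sum_distrib_left distrib_left
             del: sum.lessThan_Suc)
  also have "\<dots> = monom (real (desc (a # b # w))) (desc (a # b # w)) +
    monom (real (length (a # b # w)) - real (desc (a # b # w))) (Suc (desc (a # b # w)))"
    using "1.prems" unfolding IH
    by (auto simp: distrib_left mult_monom add_monom add.assoc algebra_simps)
  finally show ?case .
qed auto

lemma finite_signed_words: "finite (signed_words n)"
proof (rule finite_subset)
  show "signed_words n \<subseteq> {w. set w \<subseteq> {- int n..int n} \<and> length w = n}"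
    by (force simp: signed_words_def)
qed (simp add: finite_lists_length_eq)

lemma signed_words_memD:
  assumes "w \<in> signed_words n"
  shows "length w = n" "distinct (map abs w)" "\<And>a. a \<in> set w \<Longrightarrow> 1 \<le> \<bar>a\<bar> \<and> \<bar>a\<bar> \<le> int n"
proof -
  show len: "length w = n"
    using assms by (simp add: signed_words_def)
  have set: "abs ` set w = {1..int n}"
    using assms by (simp add: signed_words_def)
  show "distinct (map abs w)"
    by (rule card_distinct) (simp add: set len)
  show "1 \<le> \<bar>a\<bar> \<and> \<bar>a\<bar> \<le> int n" if "a \<in> set w" for a
    using that set by (metis atLeastAtMost_iff imageI)
qed

lemma sum_signed_words_Suc:
  fixes g :: "int list \<Rightarrow> 'a::comm_monoid_add"
  shows "(\<Sum>w\<in>signed_words (Suc n). g w) =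
    (\<Sum>w\<in>signed_words n. \<Sum>k\<le>n.
       g (insert_at k (int (Suc n)) w) + g (insert_at k (- int (Suc n)) w))"
proof -
  let ?N = "int (Suc n)"
  let ?small = "\<lambda>a. \<bar>a\<bar> \<le> int n"
  let ?pos = "\<lambda>v. length (takeWhile ?small v)"
  have "(\<Sum>(w, k, x)\<in>signed_words n \<times> {..n} \<times> {?N, - ?N}. g (insert_at k x w)) =
    (\<Sum>w\<in>signed_words (Suc n). g w)"
  \<comment> \<open>Exactly one entry of a longer word has absolute value \<open>Suc n\<close>:
    \<open>filter\<close> deletes it, and \<open>takeWhile\<close> stops at its position.\<close>
  proof (rule sum.reindex_bij_witness[where
        j = "\<lambda>(w, k, x). insert_at k x w" and
        i = "\<lambda>v. (filter ?small v, ?pos v, v ! ?pos v)"])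
    fix y assume "y \<in> signed_words n \<times> {..n} \<times> {?N, - ?N}"
    then obtain w k x where y: "y = (w, k, x)" and w: "w \<in> signed_words n" and k: "k \<le> n"
      and x: "x = ?N \<or> x = - ?N"
      by auto
    note wD = signed_words_memD[OF w]
    have small: "\<forall>a\<in>set (take k w). ?small a" "\<forall>a\<in>set (drop k w). ?small a"
      using wD(3) by (meson in_set_takeD in_set_dropD)+
    have nx: "\<not> ?small x"
      using x by auto
    have tw: "takeWhile ?small (insert_at k x w) = take k w"
      unfolding insert_at_def using small nx by (subst takeWhile_append2) auto
    have fl: "filter ?small (insert_at k x w) = w"
    proof -
      have "filter ?small (insert_at k x w) = take k w @ drop k w"
        unfolding insert_at_def using small nx by (simp add: filter_id_conv)
      then show ?thesis by simp
    qed
    have "insert_at k x w ! ?pos (insert_at k x w) = x"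
      unfolding tw using wD(1) k by (simp add: insert_at_def nth_append)
    then show "(case y of (w, k, x) \<Rightarrow> insert_at k x w) \<in> signed_words (Suc n)"
      and "(\<lambda>v. (filter ?small v, ?pos v, v ! ?pos v)) (case y of (w, k, x) \<Rightarrow> insert_at k x w) = y"
      using w x tw fl wD(1) k y by (auto simp: signed_words_def)
  next
    fix v assume v: "v \<in> signed_words (Suc n)"
    note vD = signed_words_memD[OF v]
    have "?N \<in> abs ` set v"
      using v by (simp add: signed_words_def)
    then obtain x where x: "x \<in> set v" "\<bar>x\<bar> = ?N"
      by auto
    then obtain us vs where uv: "v = us @ x # vs"
      by (meson split_list)
    have small: "?small a" if "a \<in> set us \<union> set vs" for a
    proof -
      have "\<bar>a\<bar> \<noteq> \<bar>x\<bar>"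
        using vD(2) that unfolding uv by (auto simp: image_iff)
      moreover have "\<bar>a\<bar> \<le> ?N"
        using vD(3)[of a] that uv by auto
      ultimately show ?thesis
        using x by simp
    qed
    have tw: "takeWhile ?small v = us"
      unfolding uv using small x by (subst takeWhile_append2) auto
    have fl: "filter ?small v = us @ vs"
      unfolding uv using small x by (auto simp: filter_id_conv)
    have nth: "v ! ?pos v = x"
      unfolding tw by (simp add: uv)
    have len: "length us + length vs = n"
      using vD(1) uv by simp
    have "abs ` set (us @ vs) = abs ` set v - {?N}"
    proof -
      have "?N \<notin> abs ` set (us @ vs)"
        using small by fastforce
      then show ?thesis
        using x by (auto simp: uv)
    qed
    also have "\<dots> = {1..int n}"
      using v by (auto simp: signed_words_def)
    finally show "(filter ?small v, ?pos v, v ! ?pos v) \<in> signed_words n \<times> {..n} \<times> {?N, - ?N}"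
      using len x unfolding nth fl unfolding tw by (auto simp: signed_words_def)
    show "(case (filter ?small v, ?pos v, v ! ?pos v) of (w, k, x) \<Rightarrow> insert_at k x w) = v"
      unfolding nth fl unfolding tw by (simp add: insert_at_def uv)
  qed auto
  moreover have "(\<Sum>(w, k, x)\<in>signed_words n \<times> {..n} \<times> {?N, - ?N}. g (insert_at k x w)) =
    (\<Sum>w\<in>signed_words n. \<Sum>k\<le>n. g (insert_at k ?N w) + g (insert_at k (- ?N) w))"
    by (simp add: sum.cartesian_product[symmetric] del: of_nat_Suc)
  ultimately show ?thesis by simp
qed

section \<open>Signed permutations as signed words\<close>

definition word_of :: "nat \<Rightarrow> (int \<Rightarrow> int) \<Rightarrow> int list" where
  "word_of n \<pi> = map (\<lambda>i. \<pi> (int i + 1)) [0..<n]"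

lemma des_A_eq_desc: "des_A n \<pi> = desc (word_of n \<pi>)"
proof -
  have "des_A n \<pi> = card ((\<lambda>i. int i + 1) ` {i \<in> {..<n - 1}. \<pi> (int i + 1) > \<pi> (int i + 2)})"
    unfolding des_A_def
  proof (rule arg_cong[where f = card], safe)
    fix i assume i: "i \<in> {1..int n - 1}" "\<pi> i > \<pi> (i + 1)"
    then show "i \<in> (\<lambda>i. int i + 1) ` {i \<in> {..<n - 1}. \<pi> (int i + 1) > \<pi> (int i + 2)}"
      by (intro image_eqI[of _ _ "nat (i - 1)"]) (auto simp: add.commute)
  qed (auto simp: add.commute)
  also have "\<dots> = card {i \<in> {..<n - 1}. \<pi> (int i + 1) > \<pi> (int i + 2)}"
    by (rule card_image) (auto simp: inj_on_def)
  also have "\<dots> = (\<Sum>i<n - 1. of_bool (\<pi> (int i + 1) > \<pi> (int i + 2)))"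
    by (simp add: of_bool_def sum.If_cases Int_def)
  also have "\<dots> = desc (word_of n \<pi>)"
    unfolding desc_conv_sum word_of_def by (intro sum.cong) (auto simp: add.commute)
  finally show ?thesis .
qed

lemma signed_perms_uminus:
  assumes "\<pi> \<in> signed_perms n"
  shows "\<pi> (- i) = - \<pi> i"
proof (cases "i \<in> pm_interval n")
  case True
  then show ?thesis using assms by (simp add: signed_perms_def)
next
  case False
  moreover from this have "- i \<notin> pm_interval n"
    by (auto simp: pm_interval_def)
  ultimately show ?thesis
    using assms permutes_not_in[of \<pi> "pm_interval n"] by (simp add: signed_perms_def)
qed

text \<open>Oddness recovers the values at negative arguments from the word, and
  \<open>permutes\<close> fixes those outside \<open>pm_interval n\<close>.\<close>

lemma bij_betw_word_of: "bij_betw (word_of n) (signed_perms n) (signed_words n)"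
proof (rule bij_betw_imageI)
  show "inj_on (word_of n) (signed_perms n)"
  proof (rule inj_onI, rule ext)
    fix \<pi> \<sigma> i assume \<pi>: "\<pi> \<in> signed_perms n" and \<sigma>: "\<sigma> \<in> signed_perms n"
      and eq: "word_of n \<pi> = word_of n \<sigma>"
    have pos: "\<pi> j = \<sigma> j" if "1 \<le> j" "j \<le> int n" for j
    proof -
      have "word_of n \<pi> ! nat (j - 1) = word_of n \<sigma> ! nat (j - 1)"
        using eq by simp
      moreover have "nat (j - 1) < n" "int (nat (j - 1)) + 1 = j"
        using that by auto
      ultimately show ?thesis
        by (simp add: word_of_def)
    qed
    consider "i \<notin> pm_interval n" | "1 \<le> i" "i \<le> int n" | "1 \<le> - i" "- i \<le> int n"
      by (force simp: pm_interval_def)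
    then show "\<pi> i = \<sigma> i"
    proof cases
      case 1
      then show ?thesis
        using \<pi> \<sigma> permutes_not_in[of \<pi> "pm_interval n" i]
          permutes_not_in[of \<sigma> "pm_interval n" i] by (simp add: signed_perms_def)
    next
      case 3
      then show ?thesis
        using pos[of "- i"] signed_perms_uminus[OF \<pi>, of i] signed_perms_uminus[OF \<sigma>, of i] by simp
    qed (use pos in auto)
  qed
next
  show "word_of n ` signed_perms n = signed_words n"
  proof (intro equalityI subsetI)
    fix w assume "w \<in> word_of n ` signed_perms n"
    then obtain \<pi> where \<pi>: "\<pi> \<in> signed_perms n" and w: "w = word_of n \<pi>"
      by auto
    have perm: "\<pi> permutes pm_interval n"
      using \<pi> by (simp add: signed_perms_def)
    have set_w: "set w = \<pi> ` {1..int n}"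
    proof -
      have "{1..int n} = (\<lambda>i. int i + 1) ` {0..<n}"
      proof (intro equalityI subsetI)
        fix j assume "j \<in> {1..int n}"
        then show "j \<in> (\<lambda>i. int i + 1) ` {0..<n}"
          by (intro image_eqI[of _ _ "nat (j - 1)"]) auto
      qed auto
      then show ?thesis
        by (simp add: w word_of_def image_image)
    qed
    have "abs ` \<pi> ` {1..int n} = {1..int n}"
    proof (intro equalityI subsetI)
      fix a assume "a \<in> abs ` \<pi> ` {1..int n}"
      then obtain i where "i \<in> {1..int n}" "a = \<bar>\<pi> i\<bar>"
        by auto
      moreover from this have "\<pi> i \<in> pm_interval n"
        using permutes_in_image[OF perm, of i] by (auto simp: pm_interval_def)
      ultimately show "a \<in> {1..int n}"
        by (auto simp: pm_interval_def)
    next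
      fix a assume a: "a \<in> {1..int n}"
      then have "a \<in> \<pi> ` pm_interval n"
        using permutes_image[OF perm] by (auto simp: pm_interval_def)
      then obtain i where i: "i \<in> pm_interval n" "a = \<pi> i"
        by auto
      have "\<bar>i\<bar> \<in> {1..int n}"
        using i by (auto simp: pm_interval_def)
      moreover have "a = \<bar>\<pi> \<bar>i\<bar>\<bar>"
        using i a signed_perms_uminus[OF \<pi>, of i] by (auto simp: abs_if)
      ultimately show "a \<in> abs ` \<pi> ` {1..int n}"
        by blast
    qed
    then show "w \<in> signed_words n"
      by (simp add: signed_words_def set_w) (simp add: w word_of_def)
  next
    fix w assume w: "w \<in> signed_words n"
    note wD = signed_words_memD[OF w]
    \<comment> \<open>The odd extension of \<open>w\<close>; position \<open>i\<close> of the
      permutation is index \<open>i - 1\<close> of the list.\<close>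
    define \<pi> where "\<pi> = (\<lambda>i. if i \<in> pm_interval n then sgn i * w ! nat (\<bar>i\<bar> - 1) else i)"
    have idx: "nat (\<bar>i\<bar> - 1) < length w" if "i \<in> pm_interval n" for i
      using that wD(1) by (auto simp: pm_interval_def)
    have entry: "w ! nat (\<bar>i\<bar> - 1) \<in> pm_interval n" if "i \<in> pm_interval n" for i
      using wD(3)[OF nth_mem[OF idx[OF that]]] by (auto simp: pm_interval_def)
    have sgn: "sgn i = 1 \<or> sgn i = - 1" if "i \<in> pm_interval n" for i :: int
      using that by (auto simp: pm_interval_def sgn_if)
    have perm: "\<pi> permutes pm_interval n"
    proof (rule inj_imp_permutes)
      show "inj_on \<pi> (pm_interval n)"
      proof (rule inj_onI)
        fix i j assume i: "i \<in> pm_interval n" and j: "j \<in> pm_interval n" and eq: "\<pi> i = \<pi> j"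
        have "map abs w ! nat (\<bar>i\<bar> - 1) = map abs w ! nat (\<bar>j\<bar> - 1)"
          using arg_cong[OF eq, of abs] i j idx[OF i] idx[OF j]
          by (simp add: \<pi>_def abs_mult) (auto simp: pm_interval_def)
        then have "nat (\<bar>i\<bar> - 1) = nat (\<bar>j\<bar> - 1)"
          using nth_eq_iff_index_eq[OF wD(2)] idx[OF i] idx[OF j] by (metis length_map)
        then have abs: "\<bar>i\<bar> = \<bar>j\<bar>"
          using i j by (auto simp: pm_interval_def)
        then have "sgn i = sgn j"
          using eq i j entry[OF i] by (auto simp: \<pi>_def pm_interval_def)
        with abs show "i = j"
          by (metis sgn_mult_abs)
      qed
      show "\<pi> i \<in> pm_interval n" if "i \<in> pm_interval n" for i
        using entry[OF that] sgn[OF that] that by (auto simp: \<pi>_def pm_interval_def)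
    qed (auto simp: \<pi>_def pm_interval_def)
    have "\<pi> \<in> signed_perms n"
      using perm by (auto simp: signed_perms_def \<pi>_def pm_interval_def)
    moreover have "word_of n \<pi> = w"
      using wD(1) by (intro nth_equalityI) (auto simp: word_of_def \<pi>_def pm_interval_def)
    ultimately show "w \<in> word_of n ` signed_perms n"
      by blast
  qed
qed

lemma sum_signed_perms_filter:
  assumes "n \<ge> 1"
  shows "(\<Sum>\<pi>\<in>{\<pi> \<in> signed_perms n. P (\<pi> 1)}. monom 1 (des_A n \<pi>)) =
    (\<Sum>w\<in>signed_words n. if P (hd w) then monom (1::real) (desc w) else 0)"
proof -
  have fin: "finite (signed_perms n)"
    using bij_betw_finite[OF bij_betw_word_of] finite_signed_words by blast
  have hd: "hd (word_of n \<pi>) = \<pi> 1" for \<pi>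
    using assms by (simp add: word_of_def hd_map)
  have "(\<Sum>\<pi>\<in>{\<pi> \<in> signed_perms n. P (\<pi> 1)}. monom (1::real) (des_A n \<pi>)) =
    (\<Sum>\<pi>\<in>signed_perms n. if P (\<pi> 1) then monom 1 (des_A n \<pi>) else 0)"
    using fin by (rule sum.inter_filter)
  also have "\<dots> = (\<Sum>\<pi>\<in>signed_perms n.
      (\<lambda>w. if P (hd w) then monom 1 (desc w) else 0) (word_of n \<pi>))"
    unfolding hd des_A_eq_desc ..
  also have "\<dots> = (\<Sum>w\<in>signed_words n. if P (hd w) then monom 1 (desc w) else 0)"
    by (rule sum.reindex_bij_betw[OF bij_betw_word_of])
  finally show ?thesis .
qed

lemma C_E_words:
  "n \<ge> 1 \<Longrightarrow> C_E n = (\<Sum>w\<in>signed_words n. if hd w > 0 then monom 1 (desc w) else 0)"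
  unfolding C_E_def C_plus_def by (rule sum_signed_perms_filter)

lemma C_O_words:
  "n \<ge> 1 \<Longrightarrow> C_O n = (\<Sum>w\<in>signed_words n. if hd w < 0 then monom 1 (desc w) else 0)"
  unfolding C_O_def C_minus_def by (rule sum_signed_perms_filter)

lemma signed_words_1: "signed_words 1 = {[1], [-1]}"
proof (intro equalityI subsetI)
  fix w assume "w \<in> signed_words 1"
  then show "w \<in> {[1], [-1]}"
    by (auto simp: signed_words_def length_Suc_conv)
qed (auto simp: signed_words_def)

lemma C_E_1: "C_E 1 = 1" and C_O_1: "C_O 1 = 1"
  by (simp_all only: C_E_words C_O_words le_refl signed_words_1) (simp_all add: monom_0)

section \<open>The two recurrences\<close>

lemma monom_des_step:
  fixes a b :: real
  shows "[:a, b:] * monom 1 d + [:0, 2:] * [:1, -1:] * pderiv (monom 1 d) =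
    monom (a + 2 * real d) d + monom (b - 2 * real d) (Suc d)"
proof (rule poly_eqI)
  fix k
  show "coeff ([:a, b:] * monom 1 d + [:0, 2:] * [:1, -1:] * pderiv (monom 1 d)) k =
    coeff (monom (a + 2 * real d) d + monom (b - 2 * real d) (Suc d)) k"
    by (cases d; cases k) (auto simp: pderiv_monom coeff_pCons algebra_simps split: nat.splits)
qed

text \<open>The last summand adds the non-front counts for the maximum and the minimum: (1 + d) + d
  places keep d = \<open>desc w\<close>, and (n - 1 - d) + (n - d) raise it. Only the two front
  insertions change the head; they are the source of the coupling between \<open>C_E\<close> and
  \<open>C_O\<close>.\<close>

lemma sum_insert_signed:
  fixes P :: "int \<Rightarrow> bool"
  assumes "n \<ge> 1" "w \<in> signed_words n"
  defines "g \<equiv> \<lambda>v. if P (hd v) then monom (1::real) (desc v) else 0"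
  shows "(\<Sum>k\<le>n. g (insert_at k (int (Suc n)) w) + g (insert_at k (- int (Suc n)) w)) =
    (if P (int (Suc n)) then monom 1 (Suc (desc w)) else 0) +
    (if P (- int (Suc n)) then monom 1 (desc w) else 0) +
    (if P (hd w) then monom (1 + 2 * real (desc w)) (desc w) +
       monom (2 * real n - 1 - 2 * real (desc w)) (Suc (desc w)) else 0)"
proof -
  note wD = signed_words_memD[OF assms(2)]
  let ?N = "int (Suc n)"
  have ne: "w \<noteq> []"
    using wD(1) assms by auto
  have bounds: "\<forall>a\<in>set w. a < ?N" "\<forall>a\<in>set w. - ?N < a"
    using wD(3) by force+
  have hd_ins: "hd (insert_at (Suc k) x w) = hd w" for k x
    using ne by (cases w) auto
  have "(\<Sum>k\<le>n. g (insert_at k ?N w) + g (insert_at k (- ?N) w)) =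
    g (?N # w) + g (- ?N # w) +
    ((\<Sum>k<length w. g (insert_at (Suc k) ?N w)) +
    (\<Sum>k<length w. g (insert_at (Suc k) (- ?N) w)))"
    using wD(1) by (simp add: sum.atMost_shift sum.distrib add_ac del: of_nat_Suc)
  also have "(\<Sum>k<length w. g (insert_at (Suc k) ?N w)) +
      (\<Sum>k<length w. g (insert_at (Suc k) (- ?N) w)) =
    (if P (hd w) then (\<Sum>k<length w. monom 1 (desc (insert_at (Suc k) ?N w))) +
      (\<Sum>k<length w. monom 1 (desc (insert_at (Suc k) (- ?N) w))) else 0)"
    by (simp add: g_def hd_ins del: of_nat_Suc)
  also have "\<dots> = (if P (hd w) then monom (1 + 2 * real (desc w)) (desc w) +
       monom (2 * real n - 1 - 2 * real (desc w)) (Suc (desc w)) else 0)"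
    unfolding sum_insert_max[OF ne bounds(1)] sum_insert_min[OF ne bounds(2)]
    unfolding wD(1)
    by (auto simp: poly_eq_iff)
  finally show ?thesis
    by (simp add: g_def desc_Cons_max[OF ne bounds(1)] desc_Cons_min[OF bounds(2)] del: of_nat_Suc)
qed

lemma hd_signed_word_neq_0:
  assumes "n \<ge> 1" "w \<in> signed_words n"
  shows "hd w \<noteq> 0"
proof -
  have "hd w \<in> set w"
    using signed_words_memD(1)[OF assms(2)] assms(1) by (intro hd_in_set) auto
  then show ?thesis
    using signed_words_memD(3)[OF assms(2)] by force
qed

lemma pderiv_sum: "pderiv (sum f A) = (\<Sum>x\<in>A. pderiv (f x))"
  by (induction A rule: infinite_finite_induct) (simp_all add: pderiv_add)

text \<open>Every word, whatever its head, yields x^(d+1) by the new maximum in front. For a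
  negative head this is the term x \<open>C_O n\<close>; for a positive head it raises 2n - 1 - 2d
  to 2n - 2d. The parts linear in d are what 2x(1 - x) d/dx makes of x^d.\<close>

lemma C_E_Suc:
  assumes "n \<ge> 1"
  shows "C_E (Suc n) = [:1, 2 * real n:] * C_E n + [:0, 2:] * [:1, -1:] * pderiv (C_E n)
           + [:0, 1:] * C_O n"
proof -
  let ?g = "\<lambda>w. if hd w > 0 then monom (1::real) (desc w) else 0"
  let ?h = "\<lambda>w. if hd w < 0 then monom (1::real) (desc w) else 0"
  have "C_E (Suc n) = (\<Sum>w\<in>signed_words n. [:1, 2 * real n:] * ?g w +
      [:0, 2:] * [:1, -1:] * pderiv (?g w) + [:0, 1:] * ?h w)"
    unfolding C_E_words[of "Suc n", simplified] sum_signed_words_Suc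
  proof (rule sum.cong[OF refl])
    fix w assume w: "w \<in> signed_words n"
    have X: "[:0, 1:] * monom (1::real) (desc w) = monom 1 (Suc (desc w))"
      by (simp add: monom_Suc)
    have "[:1, 2 * real n:] * ?g w + [:0, 2:] * [:1, -1:] * pderiv (?g w) + [:0, 1:] * ?h w =
      (if hd w > 0 then monom (1 + 2 * real (desc w)) (desc w) +
         monom (2 * real n - 2 * real (desc w)) (Suc (desc w)) else monom 1 (Suc (desc w)))"
      unfolding monom_des_step[of 1 "2 * real n" "desc w", symmetric]
      using hd_signed_word_neq_0[OF assms w] X by simp
    then show "(\<Sum>k\<le>n. ?g (insert_at k (int (Suc n)) w) + ?g (insert_at k (- int (Suc n)) w)) =
      [:1, 2 * real n:] * ?g w + [:0, 2:] * [:1, -1:] * pderiv (?g w) + [:0, 1:] * ?h w"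
      unfolding sum_insert_signed[OF assms w, of "\<lambda>a. a > 0"] by (auto simp: poly_eq_iff)
  qed
  also have "\<dots> = [:1, 2 * real n:] * C_E n + [:0, 2:] * [:1, -1:] * pderiv (C_E n) + [:0, 1:] * C_O n"
    unfolding C_E_words[OF assms] C_O_words[OF assms] pderiv_sum
    by (simp only: sum.distrib sum_distrib_left)
  finally show ?thesis .
qed

text \<open>Here the new minimum in front contributes x^d for every word: \<open>C_E n\<close> from
  positive heads, and for negative heads the change of 1 + 2d into 2 + 2d.\<close>

lemma C_O_Suc:
  assumes "n \<ge> 1"
  shows "C_O (Suc n) = [:2, 2 * real n - 1:] * C_O n + [:0, 2:] * [:1, -1:] * pderiv (C_O n)
           + C_E n"
proof -
  let ?g = "\<lambda>w. if hd w < 0 then monom (1::real) (desc w) else 0"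
  let ?h = "\<lambda>w. if hd w > 0 then monom (1::real) (desc w) else 0"
  have "C_O (Suc n) = (\<Sum>w\<in>signed_words n. [:2, 2 * real n - 1:] * ?g w +
      [:0, 2:] * [:1, -1:] * pderiv (?g w) + ?h w)"
    unfolding C_O_words[of "Suc n", simplified] sum_signed_words_Suc
  proof (rule sum.cong[OF refl])
    fix w assume w: "w \<in> signed_words n"
    have "[:2, 2 * real n - 1:] * ?g w + [:0, 2:] * [:1, -1:] * pderiv (?g w) + ?h w =
      (if hd w < 0 then monom (2 + 2 * real (desc w)) (desc w) +
         monom (2 * real n - 1 - 2 * real (desc w)) (Suc (desc w)) else monom 1 (desc w))"
      unfolding monom_des_step[of 2 "2 * real n - 1" "desc w", symmetric]
      using hd_signed_word_neq_0[OF assms w] by simp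
    then show "(\<Sum>k\<le>n. ?g (insert_at k (int (Suc n)) w) + ?g (insert_at k (- int (Suc n)) w)) =
      [:2, 2 * real n - 1:] * ?g w + [:0, 2:] * [:1, -1:] * pderiv (?g w) + ?h w"
      unfolding sum_insert_signed[OF assms w, of "\<lambda>a. a < 0"] by (auto simp: poly_eq_iff)
  qed
  also have "\<dots> = [:2, 2 * real n - 1:] * C_O n + [:0, 2:] * [:1, -1:] * pderiv (C_O n) + C_E n"
    unfolding C_E_words[OF assms] C_O_words[OF assms] pderiv_sum
    by (simp only: sum.distrib sum_distrib_left)
  finally show ?thesis .
qed

subsection \<open>Zeros of the Eulerian polynomials\<close>

abbreviation cpoly :: "real poly \<Rightarrow> complex poly" where
  "cpoly p \<equiv> map_poly complex_of_real p"

lemma cpoly_add: "cpoly (p + q) = cpoly p + cpoly q"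
  by (rule poly_eqI) (simp add: coeff_map_poly)

lemma cpoly_mult: "cpoly (p * q) = cpoly p * cpoly q"
  by (rule poly_eqI) (simp add: coeff_map_poly coeff_mult)

lemma cpoly_pCons: "cpoly (pCons a p) = pCons (of_real a) (cpoly p)"
  by (rule poly_eqI) (simp add: coeff_map_poly coeff_pCons split: nat.splits)

lemma poly_cpoly_of_real: "poly (cpoly p) (of_real x) = of_real (poly p x)"
  by (induction p) (simp_all add: cpoly_pCons)

lemma cpoly_smult: "cpoly (smult a p) = smult (of_real a) (cpoly p)"
  by (rule poly_eqI) (simp add: coeff_map_poly)

lemma cpoly_minus: "cpoly (- p) = - cpoly p"
  by (rule poly_eqI) (simp add: coeff_map_poly)

lemmas cpoly_simps = cpoly_minus cpoly_add cpoly_mult cpoly_pCons cpoly_smult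

text \<open>The fundamental theorem of algebra supplies a complex zero, which the hypothesis makes
  real and negative; it is divided off and the degree drops. A list keeps multiplicities.\<close>

lemma real_negative_zeros_factorization:
  assumes "p \<noteq> 0" "only_real_negative_zeros p"
  shows "\<exists>rs. p = smult (lead_coeff p) (\<Prod>r\<leftarrow>rs. [:r, 1:]) \<and> (\<forall>r\<in>set rs. r > 0)"
  using assms
proof (induction "degree p" arbitrary: p rule: less_induct)
  case less
  show ?case
  proof (cases "degree p = 0")
    case True
    then obtain c where "p = [:c:]"
      by (meson degree_eq_zeroE)
    then show ?thesis
      by (intro exI[of _ "[]"]) simp
  next
    case False
    have "degree (cpoly p) = degree p"
      by (simp add: degree_map_poly)
    then obtain w where w: "poly (cpoly p) w = 0"
      using False fundamental_theorem_of_algebra[of "cpoly p"] by (auto simp: constant_degree)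
    then have "w \<in> \<real>" "Re w < 0"
      using less.prems by (auto simp: only_real_negative_zeros_def)
    then obtain x where x: "w = of_real x" "x < 0"
      by (auto elim: Reals_cases)
    have "poly p x = 0"
      using w x by (simp add: poly_cpoly_of_real)
    then obtain q where q: "p = [:- x, 1:] * q"
      by (auto simp: poly_eq_0_iff_dvd dvd_def)
    have q0: "q \<noteq> 0"
      using q less.prems by auto
    have "degree q < degree p"
      unfolding q using q0 by (subst degree_mult_eq) auto
    moreover have "only_real_negative_zeros q"
      using less.prems(2) unfolding only_real_negative_zeros_def q cpoly_mult poly_mult by simp
    ultimately obtain rs where rs: "q = smult (lead_coeff q) (\<Prod>r\<leftarrow>rs. [:r, 1:])"
      "\<forall>r\<in>set rs. r > 0"
      using less.hyps q0 by blast
    have "lead_coeff p = lead_coeff q"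
      unfolding q by (simp only: lead_coeff_mult) simp
    then have "p = smult (lead_coeff p) (\<Prod>r\<leftarrow>- x # rs. [:r, 1:])"
      using q rs(1) by (metis list.simps(9) mult_smult_right prod_list.Cons)
    moreover have "\<forall>r\<in>set (- x # rs). r > 0"
      using rs(2) x by auto
    ultimately show ?thesis
      by blast
  qed
qed

text \<open>Normalised by descents, without an extra factor x: for n > 0 the coefficient of x^k
  counts the permutations of n letters with k descents.\<close>

primrec eulerian :: "nat \<Rightarrow> real poly" where
  "eulerian 0 = 1"
| "eulerian (Suc n) = [:1, real n:] * eulerian n + [:0, 1, -1:] * pderiv (eulerian n)"

lemma coeff_eulerian_Suc:
  "coeff (eulerian (Suc n)) k = (1 + real k) * coeff (eulerian n) k +
     (if k = 0 then 0 else (real n + 1 - real k) * coeff (eulerian n) (k - 1))"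
  by (cases k) (auto simp: coeff_pCons coeff_pderiv algebra_simps split: nat.splits)

text \<open>Vanishing and nonnegativity go through one induction: the weight of
  \<open>coeff_eulerian_Suc\<close> on the lower coefficient becomes negative for large k, where
  that coefficient is already zero.\<close>

lemma eulerian_coeffs:
  "coeff (eulerian (Suc n)) 0 = 1 \<and> coeff (eulerian (Suc n)) n = 1 \<and>
   (\<forall>k>n. coeff (eulerian (Suc n)) k = 0) \<and> (\<forall>k. coeff (eulerian (Suc n)) k \<ge> 0)"
proof (induction n)
  case 0
  then show ?case
    by (auto simp: coeff_eulerian_Suc coeff_pCons simp del: eulerian.simps(2) split: nat.splits)
next
  case (Suc n)
  have "coeff (eulerian (Suc (Suc n))) k \<ge> 0" for k
  proof (cases "k \<le> Suc n")
    case True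
    then show ?thesis
      using Suc by (auto simp: coeff_eulerian_Suc[of "Suc n"] simp del: eulerian.simps)
  next
    case False
    then show ?thesis
      using Suc by (auto simp: coeff_eulerian_Suc[of "Suc n"] simp del: eulerian.simps)
  qed
  then show ?case
    using Suc by (auto simp: coeff_eulerian_Suc[of "Suc n"] simp del: eulerian.simps)
qed

lemma degree_eulerian: "degree (eulerian (Suc n)) = n"
  and lead_coeff_eulerian: "lead_coeff (eulerian (Suc n)) = 1"
proof -
  show deg: "degree (eulerian (Suc n)) = n"
    using eulerian_coeffs[of n]
    by (intro antisym degree_le le_degree) (auto simp del: eulerian.simps)
  show "lead_coeff (eulerian (Suc n)) = 1"
    unfolding deg using eulerian_coeffs by blast
qed

lemma eulerian_pos:
  assumes "x \<ge> 0"
  shows "poly (eulerian n) x > 0"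
proof (cases n)
  case (Suc m)
  let ?p = "eulerian (Suc m)"
  have "(\<Sum>i\<in>{0}. coeff ?p i * x ^ i) \<le> (\<Sum>i\<le>degree ?p. coeff ?p i * x ^ i)"
    using assms eulerian_coeffs[of m] by (intro sum_mono2) (auto simp del: eulerian.simps)
  then show ?thesis
    using eulerian_coeffs[of m] by (simp add: Suc poly_altdef del: eulerian.simps)
qed simp

text \<open>The factor \<open>1 - w\<close> turns each term \<open>1 / (w + r)\<close> of the logarithmic derivative into
  \<open>(1 + r) / (w + r) - 1\<close>, so that all nonreal contributions have imaginary part of the same sign.\<close>

lemma log_derivative_linear_factors:
  fixes w :: complex
  assumes "Im w \<noteq> 0"
  defines "P \<equiv> \<lambda>rs. \<Prod>r\<leftarrow>rs. [:r, 1:]"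
  shows "poly (cpoly (P rs)) w \<noteq> 0"
    and "(1 - w) * poly (cpoly (pderiv (P rs))) w =
      poly (cpoly (P rs)) w * ((\<Sum>r\<leftarrow>rs. of_real (1 + r) / (w + of_real r)) - of_nat (length rs))"
proof -
  have nz: "w + of_real r \<noteq> 0" for r
    using assms(1) by (auto simp: complex_eq_iff)
  show "poly (cpoly (P rs)) w \<noteq> 0"
  proof (induction rs)
    case (Cons r rs)
    have "poly (cpoly (P (r # rs))) w = (w + of_real r) * poly (cpoly (P rs)) w"
      by (simp add: P_def cpoly_simps map_poly_1' algebra_simps)
    then show ?case
      using Cons nz by simp
  qed (simp add: P_def map_poly_1')
  show "(1 - w) * poly (cpoly (pderiv (P rs))) w =
      poly (cpoly (P rs)) w * ((\<Sum>r\<leftarrow>rs. of_real (1 + r) / (w + of_real r)) - of_nat (length rs))"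
  proof (induction rs)
    case Nil
    then show ?case by (simp add: P_def)
  next
    case (Cons r rs)
    let ?p = "poly (cpoly (P rs)) w" and ?d = "poly (cpoly (pderiv (P rs))) w"
    let ?S = "(\<Sum>r\<leftarrow>rs. of_real (1 + r) / (w + of_real r)) - of_nat (length rs)"
    have P: "P (r # rs) = [:r, 1:] * P rs"
      by (simp add: P_def)
    have "(1 - w) * poly (cpoly (pderiv (P (r # rs)))) w =
      (1 - w) * ?p + (w + of_real r) * ((1 - w) * ?d)"
      unfolding P pderiv_mult by (simp add: pderiv_pCons cpoly_simps map_poly_1' algebra_simps)
    also have "\<dots> = (1 - w) * ?p + (w + of_real r) * (?p * ?S)"
      unfolding Cons.IH ..
    also have "\<dots> = ((w + of_real r) * ?p) * (of_real (1 + r) / (w + of_real r) + ?S - 1)"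
      using nz[of r] by (simp add: field_simps)
    also have "(w + of_real r) * ?p = poly (cpoly (P (r # rs))) w"
      unfolding P by (simp add: cpoly_simps map_poly_1' algebra_simps)
    finally show ?case
      by (simp add: algebra_simps)
  qed
qed

text \<open>The factor \<open>Im w\<close> treats both half planes at once: each term contributes
  -(1 + r) (Im w)^2 / |w + r|^2.\<close>

lemma Im_sum_resolvents:
  fixes w :: complex
  assumes "\<forall>r\<in>set rs. r > 0"
  shows "Im (\<Sum>r\<leftarrow>rs. of_real (1 + r) / (w + of_real r)) * Im w \<le> 0"
  using assms
proof (induction rs)
  case (Cons r rs)
  have "Im (of_real (1 + r) / (w + of_real r)) * Im w =
      - ((1 + r) * (Im w)\<^sup>2 / ((Re w + r)\<^sup>2 + (Im w)\<^sup>2))"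
    by (simp add: Im_divide power2_eq_square)
  moreover have "(1 + r) * (Im w)\<^sup>2 / ((Re w + r)\<^sup>2 + (Im w)\<^sup>2) \<ge> 0"
    using Cons.prems by (intro divide_nonneg_nonneg mult_nonneg_nonneg) auto
  ultimately have "Im (of_real (1 + r) / (w + of_real r)) * Im w \<le> 0"
    by linarith
  with Cons show ?case
    by (simp only: list.map sum_list.Cons plus_complex.sel distrib_right) auto
qed simp

text \<open>At a nonreal zero the recurrence, divided by c w P(w), reads 1/w + S + real constant =
  0. The imaginary parts of 1/w and S have compatible signs, and that of 1/w is nonzero, a
  contradiction. Real zeros are negative by \<open>eulerian_pos\<close>.\<close>

lemma eulerian_real_negative_zeros: "only_real_negative_zeros (eulerian n)"
proof (induction n)
  case 0
  then show ?case by (simp add: only_real_negative_zeros_def map_poly_1')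
next
  case (Suc n)
  have ne: "eulerian n \<noteq> 0"
    using eulerian_pos[of 0 n] by auto
  define c where "c = lead_coeff (eulerian n)"
  have c: "c \<noteq> 0"
    using ne by (simp add: c_def)
  obtain rs where rs: "eulerian n = smult c (\<Prod>r\<leftarrow>rs. [:r, 1:])" "\<forall>r\<in>set rs. r > 0"
    using real_negative_zeros_factorization[OF ne Suc.IH] by (auto simp: c_def)
  show ?case
    unfolding only_real_negative_zeros_def
  proof (intro allI impI)
    fix w assume zero: "poly (cpoly (eulerian (Suc n))) w = 0"
    have "Im w = 0"
    proof (rule ccontr)
      assume Im: "Im w \<noteq> 0"
      then have w0: "w \<noteq> 0"
        by auto
      let ?P = "\<Prod>r\<leftarrow>rs. [:r, 1:]"
      let ?p = "poly (cpoly ?P) w" and ?d = "poly (cpoly (pderiv ?P)) w"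
      let ?S = "\<Sum>r\<leftarrow>rs. of_real (1 + r) / (w + of_real r)"
      note log = log_derivative_linear_factors[OF Im, of rs]
      have "poly (cpoly (eulerian (Suc n))) w =
          of_real c * ((1 + of_nat n * w) * ?p + w * ((1 - w) * ?d))"
        by (simp add: rs(1) pderiv_smult cpoly_simps map_poly_1' algebra_simps)
      also have "\<dots> = of_real c * ?p * w * (1 / w + ?S + of_nat n - of_nat (length rs))"
        unfolding log(2) using w0 by (simp add: field_simps)
      finally have "1 / w + ?S + of_nat n - of_nat (length rs) = 0"
        using zero c w0 log(1) by simp
      then have "Im (1 / w + ?S + of_nat n - of_nat (length rs)) = 0"
        by simp
      then have "Im (1 / w) * Im w + Im ?S * Im w = 0"
        by (simp flip: distrib_right)
      moreover have "Im (1 / w) * Im w < 0"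
        using Im by (simp add: Im_divide power2_eq_square[symmetric] field_simps sum_power2_gt_zero_iff
            add_nonneg_pos)
      ultimately show False
        using Im_sum_resolvents[OF rs(2), of w] by linarith
    qed
    then have w: "w = of_real (Re w)"
      by (simp add: complex_eq_iff)
    then have "poly (eulerian (Suc n)) (Re w) = 0"
      using zero by (metis of_real_eq_0_iff poly_cpoly_of_real)
    then have "Re w < 0"
      using eulerian_pos[of "Re w" "Suc n"] by (metis less_irrefl not_le)
    with w show "w \<in> \<real> \<and> Re w < 0"
      by (metis Reals_of_real)
  qed
qed

subsection \<open>Even and odd parts of polynomials with negative zeros\<close>

lemma card_even_less: "card {j. j < k \<and> even j} = Suc k div 2"
proof (induction k)
  case (Suc k)
  have "{j. j < Suc k \<and> even j} = (if even k then insert k else id) {j. j < k \<and> even j}"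
    by (auto simp: less_Suc_eq)
  then show ?case
    using Suc by (auto simp: card_insert_if)
qed simp

lemma card_odd_less: "card {j. j < k \<and> odd j} = k div 2"
proof (induction k)
  case (Suc k)
  have "{j. j < Suc k \<and> odd j} = (if odd k then insert k else id) {j. j < k \<and> odd j}"
    by (auto simp: less_Suc_eq)
  then show ?case
    using Suc by (auto simp: card_insert_if)
qed simp

lemma degree_prod_linear: "degree (\<Prod>k\<in>K. [:- y k, 1:]) = card K"
  for y :: "'b \<Rightarrow> 'a::idom"
  by (subst degree_prod_eq_sum_degree) auto

lemma lead_coeff_prod_linear: "lead_coeff (\<Prod>k\<in>K. [:- y k, 1:]) = 1"
  for y :: "'b \<Rightarrow> 'a::idom"
  by (subst lead_coeff_prod) simp

text \<open>Both sides share degree bound and leading coefficient, so agreement at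
  \<open>degree p\<close> points suffices.\<close>

lemma poly_eq_prod_distinct_roots:
  fixes p :: "'a::idom poly"
  assumes "inj_on y K" "card K = degree p" "\<And>k. k \<in> K \<Longrightarrow> poly p (y k) = 0" "finite K"
  shows "p = smult (lead_coeff p) (\<Prod>k\<in>K. [:- y k, 1:])"
proof (rule poly_eqI_degree_lead_coeff[where A = "y ` K" and n = "degree p"])
  show "lead_coeff p = coeff (smult (lead_coeff p) (\<Prod>k\<in>K. [:- y k, 1:])) (degree p)"
    using lead_coeff_prod_linear[of y K] assms(2) by (simp add: degree_prod_linear)
  show "degree (smult (lead_coeff p) (\<Prod>k\<in>K. [:- y k, 1:])) \<le> degree p"
    using degree_smult_le[of "lead_coeff p" "\<Prod>k\<in>K. [:- y k, 1:]"] assms(2)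
    by (simp add: degree_prod_linear)
qed (use assms in \<open>auto simp: card_image poly_prod\<close>)

lemma degree_add_pos_coeffs:
  fixes p q :: "real poly"
  assumes "degree p \<le> d" "degree q \<le> d" "coeff p d \<ge> 0" "coeff q d > 0"
  shows "degree (p + q) = d" "lead_coeff (p + q) > 0"
proof -
  show deg: "degree (p + q) = d"
    using assms by (intro antisym degree_add_le le_degree) auto
  show "lead_coeff (p + q) > 0"
    unfolding deg using assms by simp
qed

text \<open>Reflection x -> -x moves the question to plus infinity. The bound \<open>c\<close> lets
  the point be chosen to the left of all known zeros.\<close>

lemma poly_sgn_minus_infinity:
  fixes p :: "real poly"
  assumes "lead_coeff p > 0"
  shows "\<exists>x<c. sgn (poly p x) = (-1) ^ degree p"
proof -
  let ?q = "smult ((-1) ^ degree p) (pcompose p [:0, -1:])"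
  have "lead_coeff (pcompose p [:0, -1:]) = lead_coeff p * (-1) ^ degree p"
    by (subst lead_coeff_comp) simp_all
  then have "lead_coeff ?q > 0"
    using assms by (simp add: mult.assoc mult.left_commute flip: power_add)
  then obtain b where b: "\<forall>x\<ge>b. poly ?q x \<ge> lead_coeff ?q"
    using poly_pinfty_gt_lc by blast
  define x where "x = max b (1 - c)"
  have "poly ?q x > 0"
    using b \<open>lead_coeff ?q > 0\<close> by (metis less_le_trans max.cobounded1 x_def)
  then have "(-1) ^ degree p * poly p (- x) > 0"
    by (simp add: poly_pcompose)
  then have "sgn (poly p (- x)) = (-1) ^ degree p"
    by (cases "even (degree p)") (auto simp: sgn_if)
  then show ?thesis
    by (intro exI[of _ "- x"]) (auto simp: x_def)
qed

text \<open>Only the zeros to the right of \<open>z k\<close>, those of smaller index, give negative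
  factors.\<close>

lemma sgn_prod_decreasing:
  fixes z :: "nat \<Rightarrow> real"
  assumes "\<And>i j. i < j \<Longrightarrow> j < N \<Longrightarrow> z j < z i" "S \<subseteq> {..<N}" "k < N" "k \<notin> S"
  shows "sgn (\<Prod>j\<in>S. z k - z j) = (-1) ^ card {j \<in> S. j < k}"
proof -
  have "finite S"
    using assms(2) finite_subset by blast
  then show ?thesis
    using assms(2,4)
  proof (induction S rule: finite_induct)
    case (insert a S)
    have "{j \<in> insert a S. j < k} = (if a < k then insert a else id) {j \<in> S. j < k}"
      by auto
    moreover have "sgn (z k - z a) = (if a < k then - 1 else 1)"
      using assms(1)[of a k] assms(1)[of k a] insert.prems assms(3)
      by (cases a k rule: linorder_cases) auto
    ultimately show ?case
      using insert by (auto simp: sgn_mult)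
  qed simp
qed

text \<open>The zeros of both polynomials are merged into one decreasing sequence, whose even-indexed
  terms are the zeros of \<open>p\<close> and whose odd-indexed terms are the zeros of \<open>q\<close>.\<close>

definition interlacing_chain ::
    "nat \<Rightarrow> (nat \<Rightarrow> real) \<Rightarrow> real poly \<Rightarrow> real poly \<Rightarrow> bool" where
  "interlacing_chain N z p q \<longleftrightarrow>
     (\<forall>i j. i < j \<longrightarrow> j < N \<longrightarrow> z j < z i) \<and> (\<forall>i<N. z i < 0) \<and>
     (\<exists>a>0. p = smult a (\<Prod>k\<in>{k. k < N \<and> even k}. [:- z k, 1:])) \<and>
     (\<exists>b>0. q = smult b (\<Prod>k\<in>{k. k < N \<and> odd k}. [:- z k, 1:]))"

text \<open>If \<open>p, q\<close> are the even and odd parts of \<open>F\<close>, the new pair are those of \<open>(t + r) F\<close>. Its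
  \<open>k\<close>-th zero is found by a sign change between \<open>z k\<close> and \<open>z (k - 1)\<close>, where \<open>z (- 1)\<close> means 0 and
  \<open>z N\<close> a point far to the left.\<close>

lemma interlacing_chain_step:
  assumes chain: "interlacing_chain N z p q" and r: "r > 0"
  shows "\<exists>y. interlacing_chain (Suc N) y (smult r p + [:0, 1:] * q) (p + smult r q)"
proof -
  from chain obtain a b where dec: "\<And>i j. i < j \<Longrightarrow> j < N \<Longrightarrow> z j < z i"
    and neg: "\<And>i. i < N \<Longrightarrow> z i < 0" and a: "a > 0" and b: "b > 0"
    and p: "p = smult a (\<Prod>k\<in>{k. k < N \<and> even k}. [:- z k, 1:])"
    and q: "q = smult b (\<Prod>k\<in>{k. k < N \<and> odd k}. [:- z k, 1:])"
    unfolding interlacing_chain_def by blast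
  define P where "P = smult r p + [:0, 1:] * q"
  define Q where "Q = p + smult r q"
  have deg_p: "degree p = Suc N div 2" and lc_p: "lead_coeff p = a"
    using a lead_coeff_prod_linear[of z "{k. k < N \<and> even k}"]
    by (simp_all add: p degree_prod_linear card_even_less)
  have deg_q: "degree q = N div 2" and lc_q: "lead_coeff q = b"
    using b lead_coeff_prod_linear[of z "{k. k < N \<and> odd k}"]
    by (simp_all add: q degree_prod_linear card_odd_less)
  have coeff_nonneg: "coeff f d \<ge> 0" if "degree f \<le> d" "lead_coeff f > 0" for f :: "real poly" and d
    using that by (cases "degree f = d") (auto simp: coeff_eq_0)
  \<comment> \<open>Positive leading coefficients exclude cancellation. The summand x q always
    reaches the degree of \<open>P\<close>, whereas \<open>p\<close> does so only for odd
    \<open>N\<close>.\<close>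
  have "degree p \<le> Suc (N div 2)"
    unfolding deg_p by linarith
  then have "degree (smult r p) \<le> Suc (N div 2)" "coeff (smult r p) (Suc (N div 2)) \<ge> 0"
    using coeff_nonneg[of p] lc_p a r by auto
  moreover have "degree ([:0, 1:] * q) \<le> Suc (N div 2)" "coeff ([:0, 1:] * q) (Suc (N div 2)) > 0"
    using lc_q b degree_pCons_le[of 0 q] by (auto simp: deg_q)
  ultimately have deg_P: "degree P = Suc (N div 2)" and lc_P: "lead_coeff P > 0"
    unfolding P_def by (blast intro: degree_add_pos_coeffs)+
  have "degree q \<le> Suc N div 2"
    unfolding deg_q by linarith
  then have "degree (smult r q) \<le> Suc N div 2" "coeff (smult r q) (Suc N div 2) \<ge> 0"
    using coeff_nonneg[of q] lc_q b r by auto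
  moreover have "degree p \<le> Suc N div 2" "coeff p (Suc N div 2) > 0"
    using lc_p a by (auto simp: deg_p)
  ultimately have deg_Q: "degree Q = Suc N div 2" and lc_Q: "lead_coeff Q > 0"
    unfolding Q_def add.commute[of p] by (blast intro: degree_add_pos_coeffs)+

  have sgn_p: "sgn (poly p (z k)) = (-1) ^ (Suc k div 2)" if "k < N" "odd k" for k
  proof -
    have "{j \<in> {k. k < N \<and> even k}. j < k} = {j. j < k \<and> even j}"
      using that by auto
    then show ?thesis
      using sgn_prod_decreasing[of N z "{k. k < N \<and> even k}" k] dec that a
      by (simp add: p poly_prod sgn_mult card_even_less subset_eq)
  qed
  have root_p: "poly p (z k) = 0" if "k < N" "even k" for k
    using that by (auto simp: p poly_prod)
  have sgn_q: "sgn (poly q (z k)) = (-1) ^ (k div 2)" if "k < N" "even k" for k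
  proof -
    have "{j \<in> {k. k < N \<and> odd k}. j < k} = {j. j < k \<and> odd j}"
      using that by auto
    then show ?thesis
      using sgn_prod_decreasing[of N z "{k. k < N \<and> odd k}" k] dec that b
      by (simp add: q poly_prod sgn_mult card_odd_less subset_eq)
  qed
  have root_q: "poly q (z k) = 0" if "k < N" "odd k" for k
    using that by (auto simp: q poly_prod)

  \<comment> \<open>\<open>G k\<close> is the new polynomial meant to own the \<open>k\<close>-th
    zero of the merged sequence.\<close>
  define G where "G k = (if even k then P else Q)" for k :: nat
  obtain c where c: "c < (if N = 0 then 0 else z (N - 1))"
    "sgn (poly (G N) c) = (-1) ^ degree (G N)"
    using poly_sgn_minus_infinity[of "G N"] lc_P lc_Q unfolding G_def by (cases "even N") auto
  define u where "u k = (if k = 0 then 0 else if k \<le> N then z (k - 1) else c)" for k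
  have u_less: "u (Suc k) < u k" if kN: "k \<le> N" for k
  proof -
    consider "k = N" | "k = 0" "N > 0" | "0 < k" "k < N"
      using kN by linarith
    then show ?thesis
    proof cases
      case 3
      then show ?thesis
        using dec[of "k - 1" k] by (simp add: u_def)
    qed (use c neg in \<open>auto simp: u_def split: if_splits\<close>)
  qed
  \<comment> \<open>At a point z j one of \<open>p\<close>, \<open>q\<close> vanishes, so the new
    polynomial there is a multiple of the other one, by \<open>r\<close>, by 1 or by z j.\<close>
  have sgn_right: "sgn (poly (G k) (u k)) = (-1) ^ (k div 2)" if "k \<le> N" for k
  proof (cases k)
    case 0
    have "poly p 0 > 0"
      using a neg by (auto simp: p poly_prod intro!: mult_pos_pos prod_pos)
    then show ?thesis
      using r by (simp add: 0 G_def u_def P_def)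
  next
    case (Suc j)
    show ?thesis
    proof (cases "even k")
      case True
      then show ?thesis
        using Suc that sgn_p[of j] root_q[of j] r by (simp add: G_def u_def P_def sgn_mult)
    next
      case False
      then show ?thesis
        using Suc that sgn_q[of j] root_p[of j] r by (simp add: G_def u_def Q_def sgn_mult)
    qed
  qed
  \<comment> \<open>The flip against \<open>sgn_right\<close> comes from z k < 0 in the term x q for
    even k, from one more zero of \<open>p\<close> to the right for odd k, and from the degree of
    \<open>G N\<close> at the far point c.\<close>
  have sgn_left: "sgn (poly (G k) (u (Suc k))) = (-1) ^ Suc (k div 2)" if "k \<le> N" for k
  proof (cases "k = N")
    case True
    have "degree (G N) = Suc (N div 2)"
      by (auto simp: G_def deg_P deg_Q)
    then show ?thesis
      using c True by (simp add: u_def)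
  next
    case False
    then have k: "k < N"
      using that by simp
    show ?thesis
    proof (cases "even k")
      case True
      then show ?thesis
        using k sgn_q[of k] root_p[of k] neg[of k] by (simp add: G_def u_def P_def sgn_mult)
    next
      case False
      then show ?thesis
        using k sgn_p[of k] root_q[of k] by (simp add: G_def u_def Q_def)
    qed
  qed
  have "\<exists>x. u (Suc k) < x \<and> x < u k \<and> poly (G k) x = 0" if "k \<le> N" for k
  proof -
    have "sgn (poly (G k) (u (Suc k)) * poly (G k) (u k)) = -1"
      using sgn_left[OF that] sgn_right[OF that] by (simp add: sgn_mult flip: power_add)
    then have "poly (G k) (u (Suc k)) * poly (G k) (u k) < 0"
      by (simp only: sgn_1_neg)
    then show ?thesis
      using poly_IVT[OF u_less[OF that]] by blast
  qed
  then obtain y where y: "\<And>k. k \<le> N \<Longrightarrow> u (Suc k) < y k \<and> y k < u k \<and> poly (G k) (y k) = 0"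
    by metis
  have u_mono: "u j \<le> u i" if "i \<le> j" "j \<le> Suc N" for i j
    using that
  proof (induction j rule: dec_induct)
    case (step j)
    then show ?case
      using u_less[of j] by simp
  qed simp
  have y_dec: "y j < y i" if "i < j" "j < Suc N" for i j
    using y[of i] y[of j] u_mono[of "Suc i" j] that by fastforce
  have y_neg: "y i < 0" if "i < Suc N" for i
    using y[of i] u_mono[of 0 i] that by (simp add: u_def)
  have inj: "inj_on y {..N}"
    by (rule linorder_inj_onI) (use y_dec in force)+
  \<comment> \<open>The zeros found lie in disjoint intervals and are as many as the degree, so
    there are no others.\<close>
  have "P = smult (lead_coeff P) (\<Prod>k\<in>{k. k < Suc N \<and> even k}. [:- y k, 1:])"
  proof (rule poly_eq_prod_distinct_roots)
    show "inj_on y {k. k < Suc N \<and> even k}"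
      by (rule inj_on_subset[OF inj]) auto
    show "poly P (y k) = 0" if "k \<in> {k. k < Suc N \<and> even k}" for k
      using y[of k] that by (auto simp: G_def)
  qed (auto simp: card_even_less deg_P)
  moreover have "Q = smult (lead_coeff Q) (\<Prod>k\<in>{k. k < Suc N \<and> odd k}. [:- y k, 1:])"
  proof (rule poly_eq_prod_distinct_roots)
    show "inj_on y {k. k < Suc N \<and> odd k}"
      by (rule inj_on_subset[OF inj]) auto
    show "poly Q (y k) = 0" if "k \<in> {k. k < Suc N \<and> odd k}" for k
      using y[of k] that by (auto simp: G_def)
  qed (auto simp: card_odd_less deg_Q)
  ultimately have "interlacing_chain (Suc N) y P Q"
    using y_dec y_neg lc_P lc_Q unfolding interlacing_chain_def by blast
  then show ?thesis
    unfolding P_def Q_def by blast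
qed

text \<open>Repeated entries of \<open>rs\<close> are allowed although the chain is strict. It
  starts empty at t + r, with parts r and 1, and gains one zero per factor.\<close>

lemma hermite_biehler_real_roots:
  assumes "rs \<noteq> []" "\<forall>r\<in>set rs. r > 0"
  shows "\<exists>z p q. interlacing_chain (length rs - 1) z p q \<and>
    (\<forall>t. poly (\<Prod>r\<leftarrow>rs. [:r, 1:]) t = poly p (t\<^sup>2) + t * poly q (t\<^sup>2))"
  using assms
proof (induction rs rule: list_nonempty_induct)
  case (single r)
  then have "interlacing_chain 0 (\<lambda>_. 0) [:r:] 1"
    by (auto simp: interlacing_chain_def intro!: exI[of _ r] exI[of _ 1])
  then show ?case
    by (intro exI[of _ "\<lambda>_. 0"] exI[of _ "[:r:]"] exI[of _ 1]) simp
next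
  case (cons r rs)
  then obtain z p q where chain: "interlacing_chain (length rs - 1) z p q"
    and eq: "\<And>t. poly (\<Prod>r\<leftarrow>rs. [:r, 1:]) t = poly p (t\<^sup>2) + t * poly q (t\<^sup>2)"
    by auto
  have "r > 0" "Suc (length rs - 1) = length (r # rs) - 1"
    using cons by auto
  then obtain y where "interlacing_chain (length (r # rs) - 1) y
      (smult r p + [:0, 1:] * q) (p + smult r q)"
    using interlacing_chain_step[OF chain] by metis
  moreover have "poly (\<Prod>r\<leftarrow>r # rs. [:r, 1:]) t =
    poly (smult r p + [:0, 1:] * q) (t\<^sup>2) + t * poly (p + smult r q) (t\<^sup>2)" for t
    by (simp add: eq algebra_simps power2_eq_square)
  ultimately show ?case
    by blast
qed

text \<open>Comparing t with -t separates the parts; every x > 0 is a square, and agreement on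
  infinitely many points is equality.\<close>

lemma even_odd_parts_unique:
  fixes p q p' q' :: "real poly"
  assumes "\<And>t. poly p (t\<^sup>2) + t * poly q (t\<^sup>2) = poly p' (t\<^sup>2) + t * poly q' (t\<^sup>2)"
  shows "p = p'" "q = q'"
proof -
  have parts: "poly p (t\<^sup>2) = poly p' (t\<^sup>2)" "t * poly q (t\<^sup>2) = t * poly q' (t\<^sup>2)" for t
    using assms[of t] assms[of "- t"] by (simp_all only: power2_minus mult_minus_left)
  have eq: "poly p x = poly p' x \<and> poly q x = poly q' x" if "x > 0" for x
    using parts[of "sqrt x"] that by auto
  have eqI: "f = g" if "\<And>x. x > 0 \<Longrightarrow> poly f x = poly g x" for f g :: "real poly"
  proof (rule ccontr)
    assume "f \<noteq> g"
    then have "finite {x. poly (f - g) x = 0}"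
      by (intro poly_roots_finite) auto
    moreover have "{0<..} \<subseteq> {x. poly (f - g) x = 0}"
      using that by auto
    ultimately show False
      using infinite_Ioi finite_subset by blast
  qed
  show "p = p'" "q = q'"
    using eq by (auto intro!: eqI)
qed

subsection \<open>Even and odd parts of \<open>(1 + t)^n A_n(t)\<close>\<close>

lemma C_E_C_O_eulerian:
  assumes "n \<ge> 1"
  shows "pcompose (C_E n) [:0, 0, 1:] + [:0, 1:] * pcompose (C_O n) [:0, 0, 1:] =
    [:1, 1:] ^ n * eulerian n"
  using assms
proof (induction n rule: nat_induct_at_least)
  case base
  then show ?case
    by (auto simp: C_E_1[simplified] C_O_1[simplified] pcompose_1 poly_eq_iff coeff_pCons
        split: nat.splits)
next
  case (Suc n)
  let ?E = "C_E n" and ?O = "C_O n" and ?A = "eulerian n"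
  have val: "poly ?E (t\<^sup>2) + t * poly ?O (t\<^sup>2) = (1 + t) ^ n * poly ?A t" for t
    using arg_cong[OF Suc.IH, of "\<lambda>p. poly p t"]
    by (simp add: poly_pcompose power2_eq_square)
  \<comment> \<open>The derivative of the induction hypothesis; it supplies exactly the combination
    in which \<open>pderiv ?E\<close> and \<open>pderiv ?O\<close> occur in the recurrences.\<close>
  have der: "2 * t * poly (pderiv ?E) (t\<^sup>2) + poly ?O (t\<^sup>2) + 2 * t\<^sup>2 * poly (pderiv ?O) (t\<^sup>2) =
    real n * (1 + t) ^ (n - 1) * poly ?A t + (1 + t) ^ n * poly (pderiv ?A) t" for t
    using arg_cong[OF Suc.IH, of "\<lambda>p. poly (pderiv p) t"]
    by (simp add: poly_pcompose power2_eq_square pderiv_add pderiv_mult pderiv_pcompose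
        pderiv_pCons pderiv_power algebra_simps)
  show ?case
  proof (rule poly_eq_poly_eq_iff[THEN iffD1], rule ext)
    fix t :: real
    let ?e = "poly ?E (t\<^sup>2)" and ?o = "poly ?O (t\<^sup>2)" and ?a = "poly ?A t"
    let ?de = "poly (pderiv ?E) (t\<^sup>2)" and ?do = "poly (pderiv ?O) (t\<^sup>2)" and ?da = "poly (pderiv ?A) t"
    have "poly (pcompose (C_E (Suc n)) [:0, 0, 1:] + [:0, 1:] * pcompose (C_O (Suc n)) [:0, 0, 1:]) t
      = (1 + t + 2 * real n * t\<^sup>2) * (?e + t * ?o) + t * (1 - t\<^sup>2) * (2 * t * ?de + ?o + 2 * t\<^sup>2 * ?do)"
      unfolding C_E_Suc[OF Suc.hyps] C_O_Suc[OF Suc.hyps]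
      by (simp add: poly_pcompose power2_eq_square algebra_simps)
    also have "\<dots> = (1 + t + 2 * real n * t\<^sup>2) * ((1 + t) ^ n * ?a) +
      t * (1 - t\<^sup>2) * (real n * (1 + t) ^ (n - 1) * ?a + (1 + t) ^ n * ?da)"
      unfolding val der ..
    \<comment> \<open>One factor 1 + t of 1 - t^2 restores the power n, and 1 + t + 2nt^2 + nt(1 -
      t) = (1 + t)(1 + nt).\<close>
    also have "\<dots> = (1 + t) ^ Suc n * ((1 + real n * t) * ?a + t * (1 - t) * ?da)"
    proof -
      obtain m where "n = Suc m"
        using Suc.hyps by (cases n) auto
      then show ?thesis
        by (simp add: power2_eq_square algebra_simps)
    qed
    also have "\<dots> = poly ([:1, 1:] ^ Suc n * eulerian (Suc n)) t"
      by (simp add: algebra_simps)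
    finally show "poly (pcompose (C_E (Suc n)) [:0, 0, 1:] +
        [:0, 1:] * pcompose (C_O (Suc n)) [:0, 0, 1:]) t = poly ([:1, 1:] ^ Suc n * eulerian (Suc n)) t" .
  qed
qed

lemma C_E_C_O_chain:
  assumes "n \<ge> 1"
  shows "\<exists>z. interlacing_chain (2 * (n - 1)) z (C_E n) (C_O n)"
proof -
  obtain m where n: "n = Suc m"
    using assms by (cases n) auto
  have "eulerian n \<noteq> 0"
    using eulerian_pos[of 0 n] by auto
  then obtain rs where rs: "eulerian n = (\<Prod>r\<leftarrow>rs. [:r, 1:])" "\<forall>r\<in>set rs. r > 0"
    using real_negative_zeros_factorization[OF _ eulerian_real_negative_zeros[of n]]
      lead_coeff_eulerian[of m] by (auto simp del: eulerian.simps simp: n)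
  have "degree (\<Prod>r\<leftarrow>rs. [:r, 1:]) = length rs"
    by (induction rs) (simp_all add: degree_mult_eq prod_list_zero_iff image_iff del: mult_pCons_left)
  then have len: "length rs = n - 1"
    using degree_eulerian[of m] rs(1) by (simp add: n del: eulerian.simps)
  let ?rs = "replicate n 1 @ rs"
  have "[:1, 1:] ^ n * eulerian n = (\<Prod>r\<leftarrow>?rs. [:r, 1:])"
    by (simp add: rs(1) prod_list_replicate)
  moreover obtain z p q where "interlacing_chain (length ?rs - 1) z p q" and
    pq: "\<And>t. poly (\<Prod>r\<leftarrow>?rs. [:r, 1:]) t = poly p (t\<^sup>2) + t * poly q (t\<^sup>2)"
    using hermite_biehler_real_roots[of ?rs] rs(2) assms by auto
  moreover have "poly (C_E n) (t\<^sup>2) + t * poly (C_O n) (t\<^sup>2) = poly ([:1, 1:] ^ n * eulerian n) t" for t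
    unfolding C_E_C_O_eulerian[OF assms, symmetric] by (simp add: poly_pcompose power2_eq_square)
  ultimately have "C_E n = p" "C_O n = q"
    using even_odd_parts_unique[of "C_E n" "C_O n" p q] by auto
  moreover have "length ?rs - 1 = 2 * (n - 1)"
    using len assms by simp
  ultimately show ?thesis
    using \<open>interlacing_chain (length ?rs - 1) z p q\<close> by auto
qed

section \<open>From the chain to sorted lists of zeros\<close>

lemma zeros_prod_linear:
  assumes "a \<noteq> 0" "\<And>i j. i < j \<Longrightarrow> j < m \<Longrightarrow> f j \<le> f i"
  shows "zeros (smult a (\<Prod>k<m. [:- f k, 1:])) = rev (map f [0..<m])"
proof -
  have "proots (smult a (\<Prod>k<m. [:- f k, 1:])) = mset (rev (map f [0..<m]))"
    using assms(1) by (simp add: proots_prod atLeast0LessThan) (induction m; simp add: lessThan_Suc)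
  moreover have "sorted (rev (map f [0..<m]))"
    using assms(2) by (auto simp: sorted_wrt_iff_nth_less rev_nth)
  ultimately show ?thesis
    unfolding zeros_def by (simp only: sorted_list_of_multiset_mset sorted_sort_id)
qed

lemma only_real_negative_zeros_prod:
  assumes "a \<noteq> 0" "finite K" "\<And>k. k \<in> K \<Longrightarrow> f k < 0"
  shows "only_real_negative_zeros (smult a (\<Prod>k\<in>K. [:- f k, 1:]))"
proof -
  have "poly (cpoly (\<Prod>k\<in>K. [:- f k, 1:])) w = (\<Prod>k\<in>K. w - of_real (f k))" for w
    using assms(2)
    by (induction K rule: finite_induct) (simp_all add: cpoly_simps map_poly_1' algebra_simps
        del: mult_pCons_left)
  then show ?thesis
    using assms by (auto simp: only_real_negative_zeros_def cpoly_smult)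
qed

lemma root_prec_chain:
  assumes "interlacing_chain (2 * m) z p q"
  shows "only_real_negative_zeros p" "only_real_negative_zeros q" "root_prec q p"
proof -
  from assms obtain a b where dec: "\<And>i j. i < j \<Longrightarrow> j < 2 * m \<Longrightarrow> z j < z i"
    and neg: "\<And>i. i < 2 * m \<Longrightarrow> z i < 0" and a: "a > 0" and b: "b > 0"
    and p: "p = smult a (\<Prod>k\<in>{k. k < 2 * m \<and> even k}. [:- z k, 1:])"
    and q: "q = smult b (\<Prod>k\<in>{k. k < 2 * m \<and> odd k}. [:- z k, 1:])"
    unfolding interlacing_chain_def by blast
  show neg_p: "only_real_negative_zeros p" and neg_q: "only_real_negative_zeros q"
    unfolding p q using a b neg by (auto intro!: only_real_negative_zeros_prod)
  have "{k. k < 2 * m \<and> even k} = (\<lambda>k. 2 * k) ` {..<m}"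
    by (auto elim!: evenE)
  then have p': "p = smult a (\<Prod>k<m. [:- z (2 * k), 1:])"
    unfolding p by (simp add: prod.reindex inj_on_def)
  have "{k. k < 2 * m \<and> odd k} = (\<lambda>k. 2 * k + 1) ` {..<m}"
    by (auto elim!: oddE)
  then have q': "q = smult b (\<Prod>k<m. [:- z (2 * k + 1), 1:])"
    unfolding q by (simp add: prod.reindex inj_on_def)
  have deg: "degree p = m" "degree q = m"
    using a b by (simp_all add: p' q' degree_prod_linear)
  have zeros_p: "zeros p = rev (map (\<lambda>k. z (2 * k)) [0..<m])"
    unfolding p' by (rule zeros_prod_linear) (use a dec in \<open>auto intro: less_imp_le\<close>)
  have zeros_q: "zeros q = rev (map (\<lambda>k. z (2 * k + 1)) [0..<m])"
    unfolding q' by (rule zeros_prod_linear) (use b dec in \<open>auto intro: less_imp_le\<close>)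
  \<comment> \<open>Reversal puts z (2(m - 1 - i)) at index i for \<open>p\<close> and its successor
    in the decreasing chain for \<open>q\<close>, so each zero of \<open>q\<close> lies just left of
    that of \<open>p\<close>.\<close>
  have "alternates_left q p"
    unfolding alternates_left_def deg zeros_p zeros_q
    by (auto simp: rev_nth intro!: less_imp_le dec)
  then show "root_prec q p"
    using neg_p neg_q by (auto simp: root_prec_def real_rooted_def only_real_negative_zeros_def)
qed

theorem theorem2p1:
  fixes n :: nat
  assumes "n \<ge> 1"
  shows "C_E (n + 1) = [:1, 2 * real n:] * C_E n + [:0, 2:] * [:1, -1:] * pderiv (C_E n)
           + [:0, 1:] * C_O n
       \<and> C_O (n + 1) = [:2, 2 * real n - 1:] * C_O n + [:0, 2:] * [:1, -1:] * pderiv (C_O n)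
           + C_E n
       \<and> C_E 1 = 1 \<and> C_O 1 = 1
       \<and> only_real_negative_zeros (C_E n) \<and> only_real_negative_zeros (C_O n)
       \<and> root_prec (C_O n) (C_E n)"
proof -
  obtain z where "interlacing_chain (2 * (n - 1)) z (C_E n) (C_O n)"
    using C_E_C_O_chain[OF assms] by blast
  then show ?thesis
    using C_E_Suc[OF assms] C_O_Suc[OF assms] C_E_1 C_O_1 root_prec_chain
    unfolding Suc_eq_plus1 by blast
qed

end
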